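(* Let $G=(V,E)$ be a finite simple graph with $E\neq\emptyset$, and run the rumor propagation process on $G$ starting from the configuration in which each site knows a different information. Then for every $x\in V$ the total propagation time $\tau_V$ satisfies $$\mathbb{E}[\tau_V]\le 2\,\mathbb{E}[\tau_x].$$
   Context: Rumor propagation process on a finite simple graph $G=(V,E)$ with $|V|=n$, $V=\{x_1,\dots,x_n\}$: there are $n$ informations $I_n=\{1,\dots,n\}$; $i_x(t)\subset I_n$ denotes the set of informations known by site $x$ at time $t\in\{0,1,2,\dots\}$. At each time $t$ an edge $e_{xy}\in E$ (joining $x$ and $y$) is selected uniformly at random from $E$, independently of the past, and then $i_x(t+1)=i_y(t+1)=i_x(t)\cup i_y(t)$, while $i_z(t+1)=i_z(t)$ for all $z\ne x,y$. The initial configuration in which each site knows a different information is $i_{x_k}(0)=\{k\}$, $k=1,\dots,n$. For $H\subset I_n$ the propagation time is $\tau_H=\inf\{t: H\subset i_x(t)\text{ for all }x\in V\}$ (with $\inf\emptyset=\infty$, expectations taking values in $[0,\infty]$). The total propagation time is $\tau_V=\tau_{I_n}$. For $x=x_k\in V$, $\tau_x=\tau_{\{k\}}$ is the propagation time of the single information initially known by site $x$. *)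

theory Defs
  imports "HOL-Probability.Probability"
begin

text \<open>Edges are two-element sets of vertices; this excludes loops and multiple edges.\<close>

definition finite_simple_graph :: "'v set \<Rightarrow> 'v set set \<Rightarrow> bool" where
  "finite_simple_graph V E \<longleftrightarrow> finite V \<and> (\<forall>e\<in>E. e \<subseteq> V \<and> card e = 2)"

text \<open>A configuration maps every site to the set of informations it knows.\<close>

type_synonym 'v config = "'v \<Rightarrow> nat set"

definition exchange :: "'v set \<Rightarrow> 'v config \<Rightarrow> 'v config" where
  "exchange e i = (\<lambda>z. if z \<in> e then (\<Union>y\<in>e. i y) else i z)"

lemma exchange_edge:
  "exchange {x, y} i x = i x \<union> i y"
  "exchange {x, y} i y = i x \<union> i y"
  "z \<notin> {x, y} \<Longrightarrow> exchange {x, y} i z = i z"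
  by (auto simp: exchange_def)

text \<open>The argument \<open>e\<close> is a realisation of the selected edges, \<open>e t\<close> being the edge
  selected at time \<open>t\<close>.\<close>

primrec known :: "'v config \<Rightarrow> (nat \<Rightarrow> 'v set) \<Rightarrow> nat \<Rightarrow> 'v config" where
  "known i0 e 0 = i0"
| "known i0 e (Suc t) = exchange (e t) (known i0 e t)"

text \<open>The vertices are enumerated as \<open>site 1, \<dots>, site n\<close> with \<open>n = card V\<close>;
  \<open>info_of V site x\<close> is the index of the vertex \<open>x\<close>, which is also the information that
  \<open>x\<close> knows initially.\<close>

definition infos :: "'v set \<Rightarrow> nat set" where
  "infos V = {1..card V}"

definition info_of :: "'v set \<Rightarrow> (nat \<Rightarrow> 'v) \<Rightarrow> 'v \<Rightarrow> nat" where
  "info_of V site = inv_into (infos V) site"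

definition initial_config :: "'v set \<Rightarrow> (nat \<Rightarrow> 'v) \<Rightarrow> 'v config" where
  "initial_config V site = (\<lambda>x. {info_of V site x})"

lemma initial_config_site:
  assumes "bij_betw site (infos V) V" and "k \<in> infos V"
  shows "initial_config V site (site k) = {k}"
  using assms by (simp add: initial_config_def info_of_def bij_betw_inv_into_left)

text \<open>In \<^typ>\<open>enat\<close> the infimum of the empty set is \<open>\<infinity>\<close>.\<close>

definition propagation_time ::
  "'v set \<Rightarrow> (nat \<Rightarrow> 'v) \<Rightarrow> nat set \<Rightarrow> (nat \<Rightarrow> 'v set) \<Rightarrow> enat" where
  "propagation_time V site H e =
     Inf {enat t | t. \<forall>x\<in>V. H \<subseteq> known (initial_config V site) e t x}"

definition total_propagation_time ::
  "'v set \<Rightarrow> (nat \<Rightarrow> 'v) \<Rightarrow> (nat \<Rightarrow> 'v set) \<Rightarrow> enat" where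
  "total_propagation_time V site = propagation_time V site (infos V)"

definition site_propagation_time ::
  "'v set \<Rightarrow> (nat \<Rightarrow> 'v) \<Rightarrow> 'v \<Rightarrow> (nat \<Rightarrow> 'v set) \<Rightarrow> enat" where
  "site_propagation_time V site x = propagation_time V site {info_of V site x}"

text \<open>The edges selected at times \<open>0, 1, 2, \<dots>\<close> are independent and uniformly distributed
  on \<open>E\<close>.  Measurability of each \<open>edge t\<close> is part of \<open>indep_vars\<close>.\<close>

definition uniform_edge_selection ::
  "'w measure \<Rightarrow> 'v set set \<Rightarrow> (nat \<Rightarrow> 'w \<Rightarrow> 'v set) \<Rightarrow> bool" where
  "uniform_edge_selection M E edge \<longleftrightarrow>
     prob_space M \<and>
     prob_space.indep_vars M (\<lambda>_. count_space E) edge UNIV \<and>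
     (\<forall>t. distr M (count_space E) (edge t) = uniform_count_measure E)"

definition expected_time :: "'w measure \<Rightarrow> ('w \<Rightarrow> enat) \<Rightarrow> ennreal" where
  "expected_time M T = (\<integral>\<^sup>+ w. ennreal_of_enat (T w) \<partial>M)"

end

theory Submission
  imports Defs
begin

text \<open>
  For everybody to know everything it suffices that the site \<open>x\<close> first learns everything and
  then, starting at that moment, one single information held by \<open>x\<close> reaches everybody: whatever
  carries it carries along all that \<open>x\<close> knows.  The second phase depends only on edges selected
  after a stopping time, so it has the law of \<open>\<tau>\<^sub>x\<close>.  The first phase has the law of \<open>\<tau>\<^sub>x\<close>
  as well, because an exchange is symmetric: the information of \<open>y\<close> reaches \<open>x\<close> along the edges
  \<open>e\<^sub>0, \<dots>, e\<^sub>t\<^sub>-\<^sub>1\<close> if and only if the information of \<open>x\<close> reaches \<open>y\<close> along the same edges taken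
  in the reverse order, and the first \<open>t\<close> of independent identically distributed edges may be
  reversed without changing their joint law.  Hence the factor 2.

  To express both phases by one notion, let \<open>flow e t\<close> be the relation that holds of \<open>(y, z)\<close> if
  information moves from \<open>y\<close> to \<open>z\<close> during the first \<open>t\<close> exchanges.  It is a relational product
  of symmetric relations, one for each edge, and for a relation \<open>R\<close> the time \<open>cover_time R\<close> is
  the first at which the flow contains \<open>R\<close>.  Then \<open>\<tau>\<^sub>V\<close> covers \<open>V \<times> V\<close>, \<open>\<tau>\<^sub>x\<close> covers
  \<open>{x} \<times> V\<close>, and the first phase covers the converse \<open>V \<times> {x}\<close>.  The bound follows from
  \<open>V \<times> V = (V \<times> {x}) O ({x} \<times> V)\<close> and two facts on expected cover times: they do not change when
  \<open>R\<close> is replaced by its converse (\<open>expected_cover_time_converse\<close>), and they are subadditive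
  under relational composition (\<open>expected_cover_time_relcomp\<close>).  Both hold in \<open>[0, \<infinity>]\<close>, so a
  disconnected graph, where \<open>\<tau>\<^sub>x\<close> is infinite, is no special case.
\<close>

section \<open>Flow of information along a sequence of contacts\<close>

text \<open>\<open>(y, z) \<in> contact A\<close> if \<open>z\<close> knows after an exchange within \<open>A\<close> what \<open>y\<close> knew before it; the
  identity expresses that nothing is forgotten.\<close>

definition contact :: "'v set \<Rightarrow> 'v rel" where
  "contact A = Id \<union> A \<times> A"

primrec flow :: "(nat \<Rightarrow> 'v set) \<Rightarrow> nat \<Rightarrow> 'v rel" where
  "flow e 0 = Id"
| "flow e (Suc t) = flow e t O contact (e t)"

definition cover_time :: "'v rel \<Rightarrow> (nat \<Rightarrow> 'v set) \<Rightarrow> enat" where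
  "cover_time R e = Inf {enat t | t. R \<subseteq> flow e t}"

lemma flow_add: "flow e (s + t) = flow e s O flow (\<lambda>k. e (s + k)) t"
  by (induction t) (simp_all add: O_assoc)

lemma flow_cong: "(\<And>k. k < t \<Longrightarrow> e k = e' k) \<Longrightarrow> flow e t = flow e' t"
  by (induction t) auto

lemma flow_mono: "s \<le> t \<Longrightarrow> flow e s \<subseteq> flow e t"
proof (induction t rule: dec_induct)
  case (step t)
  have "flow e t \<subseteq> flow e (Suc t)"
    by (auto simp: contact_def)
  with step.IH show ?case
    by blast
qed simp

lemma converse_contact: "(contact A)\<inverse> = contact A"
  by (auto simp: contact_def)

text \<open>The converse of a product is the product of the converses in the reverse order, and every
  factor is its own converse.\<close>

lemma flow_rev: "flow (\<lambda>k. e (t - Suc k)) t = (flow e t)\<inverse>"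
proof (induction t)
  case (Suc t)
  have "flow (\<lambda>k. e (Suc t - Suc k)) (Suc t)
      = flow (\<lambda>k. e (Suc t - Suc k)) 1 O flow (\<lambda>k. e (t - Suc k)) t"
    using flow_add[of "\<lambda>k. e (Suc t - Suc k)" 1 t] by simp
  also have "\<dots> = (flow e (Suc t))\<inverse>"
    using Suc by (simp add: converse_relcomp converse_contact)
  finally show ?case .
qed simp

text \<open>Outside \<open>V\<close> the flow is the identity, so it cannot carry anything into \<open>V\<close>.\<close>

lemma flow_closed:
  assumes "\<And>k. e k \<subseteq> V" and "(y, z) \<in> flow e t" and "z \<in> V"
  shows "y \<in> V"
  using assms(2,3)
proof (induction t arbitrary: z)
  case (Suc t)
  then show ?case
    using assms(1)[of t] by (auto simp: contact_def)
qed simp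

lemma exchange_eq_contact: "exchange A i z = (\<Union>y\<in>(contact A)\<inverse> `` {z}. i y)"
  by (auto simp: exchange_def contact_def)

lemma known_flow: "known i0 e t z = (\<Union>y\<in>(flow e t)\<inverse> `` {z}. i0 y)"
proof (induction t arbitrary: z)
  case (Suc t)
  show ?case
    unfolding known.simps flow.simps exchange_eq_contact Suc by blast
qed simp

section \<open>Cover times\<close>

text \<open>The flow grows with time, so the infimum defining a finite cover time can be tested at any
  single time.\<close>

lemma cover_time_le_iff: "cover_time R e \<le> enat t \<longleftrightarrow> R \<subseteq> flow e t"
proof
  assume "cover_time R e \<le> enat t"
  then have "Inf {enat t | t. R \<subseteq> flow e t} < enat (Suc t)"
    unfolding cover_time_def by (rule le_less_trans) simp
  then obtain s where "R \<subseteq> flow e s" "s \<le> t"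
    by (auto simp: Inf_less_iff less_Suc_eq_le)
  then show "R \<subseteq> flow e t"
    using flow_mono by blast
qed (auto simp: cover_time_def intro: Inf_lower)

lemma less_cover_time_iff: "enat t < cover_time R e \<longleftrightarrow> \<not> R \<subseteq> flow e t"
  by (metis cover_time_le_iff not_le)

lemma cover_time_eq_iff:
  "cover_time R e = enat s \<longleftrightarrow> R \<subseteq> flow e s \<and> (\<forall>t<s. \<not> R \<subseteq> flow e t)"
proof -
  have "n = s \<longleftrightarrow> n \<le> s \<and> (\<forall>t<s. t < n)" for n :: nat
    using le_neq_implies_less by blast
  then have "cover_time R e = enat s \<longleftrightarrow>
      cover_time R e \<le> enat s \<and> (\<forall>t<s. \<not> cover_time R e \<le> enat t)"
    by (cases "cover_time R e") (simp_all add: not_le)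
  then show ?thesis
    by (simp add: cover_time_le_iff)
qed

text \<open>A cover time is a stopping time: whether it equals \<open>s\<close> is decided by the first \<open>s\<close>
  contacts.\<close>

lemma cover_time_cong:
  assumes "\<And>k. k < s \<Longrightarrow> e k = e' k"
  shows "cover_time R e = enat s \<longleftrightarrow> cover_time R e' = enat s"
proof -
  have "flow e t = flow e' t" if "t \<le> s" for t
    using assms that by (intro flow_cong) auto
  then show ?thesis
    by (auto simp: cover_time_eq_iff)
qed

text \<open>This is the two-phase argument for a single sequence of contacts.\<close>

lemma cover_time_relcomp:
  assumes "cover_time R e = enat s"
  shows "cover_time (R O R') e \<le> enat s + cover_time R' (\<lambda>k. e (s + k))"
proof (cases "cover_time R' (\<lambda>k. e (s + k))")
  case (enat t)
  have "R \<subseteq> flow e s" "R' \<subseteq> flow (\<lambda>k. e (s + k)) t"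
    using assms enat by (auto simp flip: cover_time_le_iff)
  then have "R O R' \<subseteq> flow e (s + t)"
    unfolding flow_add by (rule relcomp_mono)
  then show ?thesis
    using enat by (simp add: cover_time_le_iff)
qed simp

text \<open>Different vertices start with different informations, so \<open>z\<close> knows the information of \<open>y\<close>
  only if the flow leads from \<open>y\<close> to \<open>z\<close>.\<close>

lemma propagation_time_eq_cover_time:
  assumes "\<And>k. e k \<subseteq> V" and "bij_betw site (infos V) V" and "X \<subseteq> V"
  shows "propagation_time V site (info_of V site ` X) e = cover_time (X \<times> V) e"
proof -
  have inj: "inj_on (info_of V site) V"
    using assms(2) unfolding info_of_def by (metis bij_betw_def bij_betw_inv_into)
  have "info_of V site y \<in> known (initial_config V site) e t z \<longleftrightarrow> (y, z) \<in> flow e t"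
    if "y \<in> V" "z \<in> V" for t y z
    using that inj_onD[OF inj] flow_closed[of e V _ z t, OF assms(1)]
    by (fastforce simp: known_flow initial_config_def)
  with assms(3) have "(\<forall>z\<in>V. info_of V site ` X \<subseteq> known (initial_config V site) e t z)
      \<longleftrightarrow> X \<times> V \<subseteq> flow e t" for t
    unfolding image_subset_iff by blast
  then show ?thesis
    by (simp add: propagation_time_def cover_time_def)
qed

section \<open>Expected cover times of independent identically distributed contacts\<close>

text \<open>The contacts have the common law \<open>N\<close>, and \<open>S\<close> is the law of their sequence.  That \<open>N\<close> is
  discrete makes every property of the flow up to a given time an event.\<close>

locale contact_sequence = sequence_space N for N :: "'v set measure" +
  assumes countable_space: "countable (space N)" and sets_eq_Pow: "sets N = Pow (space N)"
begin

lemma pred_flow: "Measurable.pred S (\<lambda>e. P (flow e t))"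
proof (induction t arbitrary: P)
  case (Suc t)
  have [measurable]: "{A} \<in> sets N" if "A \<in> space N" for A
    using that by (simp add: sets_eq_Pow)
  \<comment> \<open>Splitting by the last contact turns \<open>P\<close> into another predicate on the flow one step earlier,
    which is why the induction is over all \<open>P\<close>.\<close>
  have "{e \<in> space S. P (flow e (Suc t))}
      = (\<Union>A\<in>space N. {e \<in> space S. e t \<in> {A} \<and> P (flow e t O contact A)})"
    by (auto simp: space_PiM)
  moreover have "\<dots> \<in> sets S"
  proof (rule sets.countable_UN''[OF countable_space])
    fix A assume A: "A \<in> space N"
    note [measurable] = Suc[of "\<lambda>F. P (F O contact A)"]
    show "{e \<in> space S. e t \<in> {A} \<and> P (flow e t O contact A)} \<in> sets S"
      using A by measurable
  qed
  ultimately show ?case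
    by (simp add: pred_def)
qed simp

text \<open>Writing the infimum over a fixed index set makes it a countable infimum of measurable
  functions.\<close>

lemma measurable_cover_time[measurable]: "cover_time R \<in> S \<rightarrow>\<^sub>M count_space UNIV"
proof -
  have "cover_time R = (\<lambda>e. INF t. if R \<subseteq> flow e t then enat t else \<infinity>)"
    unfolding cover_time_def
    by (intro ext antisym INF_greatest Inf_greatest) (auto intro: Inf_lower INF_lower2)
  moreover have [measurable]: "Measurable.pred S (\<lambda>e. R \<subseteq> flow e t)" for t
    by (rule pred_flow[where P = "\<lambda>F. R \<subseteq> F"])
  ultimately show ?thesis
    by (simp only:) measurable
qed

text \<open>Whether the cover time exceeds \<open>t\<close> depends on the first \<open>t\<close> contacts only, and reversing
  these preserves \<open>S\<close> and replaces the flow by its converse.  The reversal depends on \<open>t\<close>, so it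
  gives equal tail probabilities for each \<open>t\<close>, which is enough since the expectation is their
  sum.\<close>

lemma expected_cover_time_converse:
  "expected_time S (cover_time (R\<inverse>)) = expected_time S (cover_time R)"
proof -
  have "emeasure S {e \<in> space S. enat t < cover_time (R\<inverse>) e}
      = emeasure S {e \<in> space S. enat t < cover_time R e}" for t
  proof -
    define r where "r k = (if k < t then t - Suc k else k)" for k
    \<comment> \<open>\<open>r\<close> is an involution.\<close>
    have "inj r"
      by (rule inj_on_inverseI[of _ r]) (auto simp: r_def)
    then have distr: "distr S S (\<lambda>e k. e (r k)) = S"
      using distr_PiM_reindex[of UNIV "\<lambda>_. N" r UNIV] M.prob_space_axioms by (simp add: restrict_UNIV)
    have flow_r: "flow (\<lambda>k. e (r k)) t = (flow e t)\<inverse>" for e :: "nat \<Rightarrow> 'v set"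
      unfolding flow_rev[symmetric] by (rule flow_cong) (simp add: r_def)
    have [measurable]: "(\<lambda>e k. e (r k)) \<in> S \<rightarrow>\<^sub>M S"
      by (rule measurable_PiM_single') (auto simp: space_PiM)
    have "emeasure S {e \<in> space S. enat t < cover_time R e}
        = emeasure (distr S S (\<lambda>e k. e (r k))) {e \<in> space S. enat t < cover_time R e}"
      by (simp add: distr)
    also have "\<dots> = emeasure S
        ((\<lambda>e k. e (r k)) -` {e \<in> space S. enat t < cover_time R e} \<inter> space S)"
      by (rule emeasure_distr) measurable
    also have "(\<lambda>e k. e (r k)) -` {e \<in> space S. enat t < cover_time R e} \<inter> space S
        = {e \<in> space S. enat t < cover_time (R\<inverse>) e}"
      by (auto simp: space_PiM less_cover_time_iff flow_r)
    finally show ?thesis ..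
  qed
  then show ?thesis
    by (simp add: expected_time_def nn_integral_enat_function)
qed

text \<open>The Markov property at a fixed time \<open>s\<close>: glueing the first \<open>s\<close> terms of one sequence to the
  start of an independent copy yields a sequence with the same law.\<close>

lemma nn_integral_split_sequence:
  assumes [measurable]: "f \<in> borel_measurable S"
  shows "(\<integral>\<^sup>+e. f e \<partial>S) = (\<integral>\<^sup>+e. \<integral>\<^sup>+e'. f (comb_seq s e e') \<partial>S \<partial>S)"
proof -
  have "(\<integral>\<^sup>+e. f e \<partial>S) = (\<integral>\<^sup>+e. f e \<partial>distr (S \<Otimes>\<^sub>M S) S (\<lambda>(e, e'). comb_seq s e e'))"
    by (simp add: PiM_comb_seq)
  also have "\<dots> = (\<integral>\<^sup>+p. f (case p of (e, e') \<Rightarrow> comb_seq s e e') \<partial>(S \<Otimes>\<^sub>M S))"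
    by (subst nn_integral_distr) auto
  also have "\<dots> = (\<integral>\<^sup>+e. \<integral>\<^sup>+e'. f (comb_seq s e e') \<partial>S \<partial>S)"
    by (subst P.nn_integral_fst[symmetric]) auto
  finally show ?thesis .
qed

text \<open>Once \<open>R\<close> is covered, at time \<open>s\<close> say, it remains to wait for the shifted sequence of contacts
  to cover \<open>R'\<close>.  The event that \<open>s\<close> is the cover time of \<open>R\<close> is independent of the shifted
  sequence, so summing over \<open>s\<close> gives the strong Markov property in the form needed here.\<close>

lemma expected_cover_time_relcomp:
  "expected_time S (cover_time (R O R'))
    \<le> expected_time S (cover_time R) + expected_time S (cover_time R')"
proof -
  let ?I = "\<lambda>s e. indicator {enat s} (cover_time R e) :: ennreal"
  have shift_measurable: "(\<lambda>e k. e (s + k)) \<in> S \<rightarrow>\<^sub>M S" for s :: nat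
    by (rule measurable_PiM_single') (auto simp: space_PiM)
  have T[measurable]: "(\<lambda>e. ennreal_of_enat (cover_time R' (\<lambda>k. e (s + k)))) \<in> borel_measurable S"
    for s
    by (rule measurable_compose[OF measurable_compose[OF shift_measurable measurable_cover_time]]) simp
  have I[measurable]: "?I s \<in> borel_measurable S" for s
    by (rule measurable_compose[OF measurable_cover_time]) simp
  \<comment> \<open>If \<open>R\<close> is never covered the series vanishes, but then the first summand is infinite.\<close>
  have le: "ennreal_of_enat (cover_time (R O R') e)
      \<le> ennreal_of_enat (cover_time R e)
         + (\<Sum>s. ?I s e * ennreal_of_enat (cover_time R' (\<lambda>k. e (s + k))))" for e
  proof (cases "cover_time R e")
    case (enat s)
    have "ennreal_of_enat (cover_time (R O R') e)
        \<le> ennreal_of_enat (enat s + cover_time R' (\<lambda>k. e (s + k)))"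
      unfolding ennreal_of_enat_le_iff using enat by (rule cover_time_relcomp)
    also have "\<dots> = ennreal_of_enat (cover_time R e)
        + (\<Sum>s'\<in>{s}. ?I s' e * ennreal_of_enat (cover_time R' (\<lambda>k. e (s' + k))))"
      using enat by simp
    also have "\<dots> \<le> ennreal_of_enat (cover_time R e)
         + (\<Sum>s. ?I s e * ennreal_of_enat (cover_time R' (\<lambda>k. e (s + k))))"
      by (intro add_left_mono sum_le_suminf) auto
    finally show ?thesis .
  qed simp
  have indep: "(\<integral>\<^sup>+e. ?I s e * ennreal_of_enat (cover_time R' (\<lambda>k. e (s + k))) \<partial>S)
      = (\<integral>\<^sup>+e. ?I s e \<partial>S) * expected_time S (cover_time R')" for s
  proof -
    have prefix: "?I s (comb_seq s e e') = ?I s e" for e e'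
      using cover_time_cong[of s "comb_seq s e e'" e R]
      by (simp add: comb_seq_less indicator_def)
    have shift: "(\<lambda>k. comb_seq s e e' (s + k)) = e'" for e e' :: "nat \<Rightarrow> 'v set"
      by (simp add: comb_seq_def)
    show ?thesis
      by (subst nn_integral_split_sequence[of _ s])
         (simp_all add: borel_measurable_times_ennreal I T prefix shift
           nn_integral_cmult nn_integral_multc expected_time_def)
  qed
  \<comment> \<open>The events that \<open>s\<close> is the cover time of \<open>R\<close> are disjoint; their probabilities need not add
    up to 1, as the cover time may be infinite.\<close>
  have "(\<Sum>s. \<integral>\<^sup>+e. ?I s e \<partial>S) = (\<integral>\<^sup>+e. (\<Sum>s. ?I s e) \<partial>S)"
    by (simp add: nn_integral_suminf)
  also have "\<dots> \<le> (\<integral>\<^sup>+e. 1 \<partial>S)"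
  proof (rule nn_integral_mono)
    fix e
    show "(\<Sum>s. ?I s e) \<le> 1"
    proof (cases "cover_time R e")
      case (enat s)
      then have "(\<Sum>s. ?I s e) = (\<Sum>s'\<in>{s}. ?I s' e)"
        by (intro suminf_finite) auto
      then show ?thesis
        using enat by simp
    qed simp
  qed
  finally have prob: "(\<Sum>s. \<integral>\<^sup>+e. ?I s e \<partial>S) \<le> 1"
    by (simp add: P.emeasure_space_1)
  have "expected_time S (cover_time (R O R'))
      \<le> (\<integral>\<^sup>+e. ennreal_of_enat (cover_time R e)
         + (\<Sum>s. ?I s e * ennreal_of_enat (cover_time R' (\<lambda>k. e (s + k)))) \<partial>S)"
    unfolding expected_time_def by (intro nn_integral_mono le)
  also have "\<dots> = expected_time S (cover_time R)
      + (\<Sum>s. \<integral>\<^sup>+e. ?I s e * ennreal_of_enat (cover_time R' (\<lambda>k. e (s + k))) \<partial>S)"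
    by (subst nn_integral_add) (simp_all add: nn_integral_suminf expected_time_def)
  also have "\<dots> = expected_time S (cover_time R)
      + (\<Sum>s. \<integral>\<^sup>+e. ?I s e \<partial>S) * expected_time S (cover_time R')"
    by (simp add: indep)
  also have "\<dots> \<le> expected_time S (cover_time R) + 1 * expected_time S (cover_time R')"
    by (intro add_left_mono mult_right_mono prob) simp
  finally show ?thesis
    by simp
qed

lemma expected_cover_time_Times:
  assumes "x \<in> V"
  shows "expected_time S (cover_time (V \<times> V)) \<le> 2 * expected_time S (cover_time ({x} \<times> V))"
proof -
  have "V \<times> V = (({x} \<times> V)\<inverse>) O ({x} \<times> V)"
    using assms by auto
  then have "expected_time S (cover_time (V \<times> V))
      \<le> expected_time S (cover_time (({x} \<times> V)\<inverse>)) + expected_time S (cover_time ({x} \<times> V))"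
    using expected_cover_time_relcomp by metis
  then show ?thesis
    unfolding expected_cover_time_converse by (simp add: mult_2)
qed

end

section \<open>The propagation process\<close>

text \<open>The expectations only involve the law of the sequence of selected edges, which by independence
  is the product measure.\<close>

lemma distr_edge_sequence:
  assumes "uniform_edge_selection M E edge"
  shows "(\<lambda>w t. edge t w) \<in> M \<rightarrow>\<^sub>M (\<Pi>\<^sub>M t\<in>UNIV. uniform_count_measure E)"
    and "distr M (\<Pi>\<^sub>M t\<in>UNIV. uniform_count_measure E) (\<lambda>w t. edge t w)
      = (\<Pi>\<^sub>M t\<in>UNIV. uniform_count_measure E)"
proof -
  interpret prob_space M
    using assms by (simp add: uniform_edge_selection_def)
  have indep: "indep_vars (\<lambda>_. count_space E) edge UNIV"
    and unif: "\<And>t. distr M (count_space E) (edge t) = uniform_count_measure E"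
    using assms by (auto simp: uniform_edge_selection_def)
  have rv: "edge t \<in> M \<rightarrow>\<^sub>M count_space E" for t
    using indep by (simp add: indep_vars_def)
  have edge_E: "edge t w \<in> E" if "w \<in> space M" for t w
    using measurable_space[OF rv that] by simp
  have sets: "sets (\<Pi>\<^sub>M t\<in>UNIV::nat set. uniform_count_measure E)
      = sets (\<Pi>\<^sub>M t\<in>UNIV::nat set. count_space E)"
    by (intro sets_PiM_cong sets_uniform_count_measure_count_space refl)
  have "(\<lambda>w t. edge t w) \<in> M \<rightarrow>\<^sub>M (\<Pi>\<^sub>M t\<in>UNIV. count_space E)"
    using rv by (intro measurable_PiM_single') (auto simp: edge_E)
  then show "(\<lambda>w t. edge t w) \<in> M \<rightarrow>\<^sub>M (\<Pi>\<^sub>M t\<in>UNIV. uniform_count_measure E)"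
    by (simp cong: measurable_cong_sets add: sets)
  have "distr M (\<Pi>\<^sub>M t\<in>UNIV. uniform_count_measure E) (\<lambda>w t. edge t w)
      = distr M (\<Pi>\<^sub>M t\<in>UNIV. count_space E) (\<lambda>w t. edge t w)"
    by (intro distr_cong sets refl)
  also have "\<dots> = (\<Pi>\<^sub>M t\<in>UNIV. uniform_count_measure E)"
    using indep_vars_iff_distr_eq_PiM[where I = UNIV and M' = "\<lambda>_. count_space E" and X = edge] rv indep
    by (simp add: unif restrict_UNIV)
  finally show "distr M (\<Pi>\<^sub>M t\<in>UNIV. uniform_count_measure E) (\<lambda>w t. edge t w)
      = (\<Pi>\<^sub>M t\<in>UNIV. uniform_count_measure E)" .
qed

theorem theorem1p1:
  fixes V :: "'v set" and E :: "'v set set"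
    and site :: "nat \<Rightarrow> 'v"
    and M :: "'w measure" and edge :: "nat \<Rightarrow> 'w \<Rightarrow> 'v set"
  assumes "finite_simple_graph V E" and "E \<noteq> {}"
    and "bij_betw site (infos V) V"
    and "uniform_edge_selection M E edge"
    and "x \<in> V"
  shows "expected_time M (\<lambda>w. total_propagation_time V site (\<lambda>t. edge t w))
       \<le> 2 * expected_time M (\<lambda>w. site_propagation_time V site x (\<lambda>t. edge t w))"
proof -
  have "finite E" and E: "\<And>A. A \<in> E \<Longrightarrow> A \<subseteq> V"
    using assms(1) finite_subset[of E "Pow V"] by (auto simp: finite_simple_graph_def)
  let ?N = "uniform_count_measure E"
  interpret N: prob_space ?N
    using \<open>finite E\<close> \<open>E \<noteq> {}\<close> by (rule prob_space_uniform_count_measure)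
  interpret contact_sequence ?N
    by unfold_locales
       (simp_all add: space_uniform_count_measure sets_uniform_count_measure
         countable_finite \<open>finite E\<close>)
  note edge_measurable[measurable] = distr_edge_sequence(1)[OF assms(4)]
  have edge_V: "edge t w \<subseteq> V" if "w \<in> space M" for t w
    using measurable_space[OF edge_measurable that] E
    by (auto simp: space_PiM space_uniform_count_measure)
  have transfer: "expected_time M (\<lambda>w. propagation_time V site (info_of V site ` X) (\<lambda>t. edge t w))
      = expected_time S (cover_time (X \<times> V))" if "X \<subseteq> V" for X
  proof -
    have "expected_time M (\<lambda>w. propagation_time V site (info_of V site ` X) (\<lambda>t. edge t w))
        = expected_time M (\<lambda>w. cover_time (X \<times> V) (\<lambda>t. edge t w))"
      unfolding expected_time_def
      by (intro nn_integral_cong arg_cong[where f = ennreal_of_enat]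
          propagation_time_eq_cover_time edge_V assms(3) that)
    also have "\<dots> = expected_time (distr M S (\<lambda>w t. edge t w)) (cover_time (X \<times> V))"
      unfolding expected_time_def by (subst nn_integral_distr) auto
    finally show ?thesis
      by (simp add: distr_edge_sequence(2)[OF assms(4)])
  qed
  have "info_of V site ` V = infos V"
    using bij_betw_inv_into[OF assms(3)] by (simp add: info_of_def bij_betw_def)
  then show ?thesis
    using transfer[of V] transfer[of "{x}"] expected_cover_time_Times[OF assms(5)] assms(5)
    by (simp add: total_propagation_time_def site_propagation_time_def)
qed

end
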